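(* Let $d\ge 2$ and $d'\ge 2$ be integers, let $G=(P,L)$ be a partial geometry $pg(s,t,\alpha)$ with parameters $$s=d(d'-1),\qquad t=d'(d-1),\qquad \alpha=(d-1)(d'-1),$$ and let $G'$ be its dual partial geometry. (a) If $C$ is a set of $m$ pairwise orthogonal parallel classes of $G$, then $$m\le d(dd'-d'+1),$$ and the equality $m=d(dd'-d'+1)$ holds if and only if every line of $G$ appears in exactly $d$ parallel classes from $C$. (b) If $C'$ is a set of $m'$ pairwise orthogonal parallel classes of $G'$, then $$m'\le d'(d'd-d+1),$$ and the equality $m'=d'(d'd-d+1)$ holds if and only if every line of $G'$ appears in exactly $d'$ parallel classes from $C'$.
   Context: A partial geometry with parameters $s,t,\alpha$, written $pg(s,t,\alpha)$, is a pair $(P,L)$ consisting of a set $P$ of points and a set $L$ of lines, with an incidence relation between points and lines, such that: (1) a pair of distinct points is not incident with more than one line; (2) every line is incident with exactly $s+1$ points ($s\ge 1$); (3) every point is incident with exactly $t+1$ lines ($t\ge 1$); (4) for every point $p$ not incident with a line $l$, there are exactly $\alpha$ lines ($\alpha\ge 1$) which are incident with $p$ and also incident with some point incident with $l$. The numbers of points and lines are $v=|P|=(s+1)(st+\alpha)/\alpha$ and $b=|L|=(t+1)(st+\alpha)/\alpha$. The dual $G'$ of $G=(P,L)$ has as points the lines of $G$ and as lines the points of $G$, with a point and a line of $G'$ incident if and only if the corresponding line and point of $G$ are incident; $G'$ is a $pg(t,s,\alpha)$. For the parameters $s=d(d'-1)$, $t=d'(d-1)$, $\alpha=(d-1)(d'-1)$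 one has $v=(s+1)(dd'+1)$ and $b=(t+1)(dd'+1)$. Two lines are disjoint if no point is incident with both. A parallel class of $G$ is a set of $v/(s+1)=dd'+1$ pairwise disjoint lines of $G$. A parallel class of $G'$ is a set of $b/(t+1)=dd'+1$ pairwise disjoint lines of $G'$. Two parallel classes of $G$ (respectively of $G'$) are called orthogonal if they share exactly one line; a set of parallel classes is pairwise orthogonal if every two distinct members are orthogonal. *)

theory Defs
  imports Complex_Main
begin

record ('p, 'l) geometry =
  points :: "'p set"
  lines :: "'l set"
  incident :: "'p \<Rightarrow> 'l \<Rightarrow> bool"

text \<open>
  Nonemptiness is implicit in the usual counting formula for the number of points; without it,
  the empty geometry would satisfy all the other axioms for every choice of parameters.
  Finiteness of the point set and of the line set follows from the axioms.
\<close>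

locale partial_geometry =
  fixes G :: "('p, 'l) geometry" and s t \<alpha> :: nat
  assumes points_nonempty: "points G \<noteq> {}"
    and s_ge_1: "s \<ge> 1"
    and t_ge_1: "t \<ge> 1"
    and alpha_ge_1: "\<alpha> \<ge> 1"
    and line_unique:
      "\<lbrakk>p \<in> points G; q \<in> points G; p \<noteq> q; l \<in> lines G; k \<in> lines G;
        incident G p l; incident G q l; incident G p k; incident G q k\<rbrakk> \<Longrightarrow> l = k"
    and card_points_on_line:
      "l \<in> lines G \<Longrightarrow> card {p \<in> points G. incident G p l} = s + 1"
    and card_lines_through_point:
      "p \<in> points G \<Longrightarrow> card {l \<in> lines G. incident G p l} = t + 1"
    and card_connecting_lines:
      "\<lbrakk>p \<in> points G; l \<in> lines G; \<not> incident G p l\<rbrakk> \<Longrightarrow>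
        card {k \<in> lines G. incident G p k \<and>
                (\<exists>q \<in> points G. incident G q l \<and> incident G q k)} = \<alpha>"

definition dual_geometry :: "('p, 'l) geometry \<Rightarrow> ('l, 'p) geometry" where
  "dual_geometry G =
     \<lparr>points = lines G, lines = points G, incident = (\<lambda>l p. incident G p l)\<rparr>"

definition disjoint_lines :: "('p, 'l) geometry \<Rightarrow> 'l \<Rightarrow> 'l \<Rightarrow> bool" where
  "disjoint_lines G l k \<longleftrightarrow> \<not> (\<exists>p \<in> points G. incident G p l \<and> incident G p k)"

text \<open>
  The parameter \<open>s\<close> is the one for which every line of the geometry has \<open>s + 1\<close> points, so that
  it is to be instantiated with \<open>t\<close> for the dual of a geometry with parameters \<open>s, t, \<alpha>\<close>.
\<close>

definition parallel_class :: "nat \<Rightarrow> ('p, 'l) geometry \<Rightarrow> 'l set \<Rightarrow> bool" where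
  "parallel_class s G X \<longleftrightarrow>
     X \<subseteq> lines G \<and>
     pairwise (disjoint_lines G) X \<and>
     real (card X) = real (card (points G)) / real (s + 1)"

definition orthogonal_classes :: "'l set \<Rightarrow> 'l set \<Rightarrow> bool" where
  "orthogonal_classes X Y \<longleftrightarrow> card (X \<inter> Y) = 1"

end

theory Submission
  imports Defs
begin

text \<open>
  The bound is a variance argument.  Put \<open>n = d * d' + 1\<close>; this is the size of every parallel
  class, and the geometry has \<open>(t + 1) * n\<close> lines.  For a line \<open>l\<close> let \<open>r l\<close> be the number of
  classes of \<open>C\<close> through \<open>l\<close>.  Counting incident pairs gives \<open>\<Sum>l. r l = m * n\<close>, and, because
  two distinct classes share exactly one line, counting triples \<open>(l, X, Y)\<close> with
  \<open>l \<in> X \<inter> Y\<close> gives \<open>\<Sum>l. (r l)\<^sup>2 = m * (m + n - 1)\<close>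
  (\<open>sum_squared_deviation_of_membership_counts\<close>).  The mean of \<open>r\<close> is \<open>m / (t + 1)\<close>, and
  with \<open>n - (t + 1) = d'\<close> and \<open>n - 1 = d * d'\<close> the sum of the squared deviations from it becomes

    \<open>(t + 1) * (\<Sum>l. (r l - m / (t + 1))\<^sup>2) = m * d' * (d * (t + 1) - m)\<close>.

  The left-hand side is nonnegative, whence \<open>m \<le> d * (t + 1)\<close>.  If equality holds, then the
  deviations vanish and every \<open>r l\<close> equals the mean, which is \<open>d\<close>.  Conversely, if \<open>r\<close> is
  constantly \<open>d\<close>, the first moment reads \<open>m * n = d * (t + 1) * n\<close>
  (\<open>orthogonal_parallel_classes_bound\<close>).

  The numbers of points and lines come from double counts in the geometry, which \<open>\<alpha> \<ge> 1\<close>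
  forces to be finite.  The second half is the first one applied to the dual, which is a partial geometry
  with the roles of \<open>d\<close> and \<open>d'\<close> exchanged (\<open>partial_geometry_dual\<close>).
\<close>

section \<open>Sets that pairwise meet in one element\<close>

text \<open>
  The first two moments of the membership count do not depend on how the sets lie in \<open>S\<close>: the
  second one counts pairs \<open>(X, Y)\<close> of sets, each weighted by the size of \<open>X \<inter> Y\<close>, which is \<open>n\<close>
  on the diagonal and \<open>1\<close> off it.
\<close>

lemma sum_squared_deviation_of_membership_counts:
  fixes S :: "'a set" and C :: "'a set set" and c :: real
  assumes fin: "finite S"
    and sub: "\<And>X. X \<in> C \<Longrightarrow> X \<subseteq> S"
    and size: "\<And>X. X \<in> C \<Longrightarrow> card X = n"
    and orth: "pairwise orthogonal_classes C"
  shows "(\<Sum>x\<in>S. (real (card {X \<in> C. x \<in> X}) - c)\<^sup>2) =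
           real (card C) * (real (card C) + real n - 1) - 2 * c * (real (card C) * real n)
             + c\<^sup>2 * real (card S)"
proof -
  have finC: "finite C"
    using sub fin by (meson Pow_iff finite_Pow_iff finite_subset subsetI)
  define r where "r = (\<lambda>x. \<Sum>X\<in>C. of_bool (x \<in> X) :: real)"
  have r: "real (card {X \<in> C. x \<in> X}) = r x" for x
    using finC by (simp add: r_def Int_def)
  have cardI: "(\<Sum>x\<in>S. of_bool (x \<in> Y) :: real) = real (card Y)" if "Y \<subseteq> S" for Y
    using fin that by (simp add: Int_absorb1)
  have first: "(\<Sum>x\<in>S. r x) = real (card C) * real n"
  proof -
    have "(\<Sum>x\<in>S. r x) = (\<Sum>X\<in>C. \<Sum>x\<in>S. of_bool (x \<in> X))"
      unfolding r_def by (rule sum.swap)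
    also have "\<dots> = (\<Sum>X\<in>C. real n)"
      using cardI sub size by (intro sum.cong) auto
    finally show ?thesis by simp
  qed
  have row: "(\<Sum>Y\<in>C. real (card (X \<inter> Y))) = real (card C) + real n - 1" if X: "X \<in> C" for X
  proof -
    have "(\<Sum>Y\<in>C. real (card (X \<inter> Y))) = real n + (\<Sum>Y\<in>C - {X}. real (card (X \<inter> Y)))"
      using X finC size by (simp add: sum.remove)
    also have "(\<Sum>Y\<in>C - {X}. real (card (X \<inter> Y))) = (\<Sum>Y\<in>C - {X}. 1)"
      using orth X by (intro sum.cong) (auto simp: pairwise_def orthogonal_classes_def)
    also have "\<dots> = real (card C) - 1"
      using X finC card_Suc_Diff1[of C X] by simp
    finally show ?thesis by simp
  qed
  have second: "(\<Sum>x\<in>S. (r x)\<^sup>2) = real (card C) * (real (card C) + real n - 1)"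
  proof -
    have "(r x)\<^sup>2 = (\<Sum>X\<in>C. \<Sum>Y\<in>C. of_bool (x \<in> X \<inter> Y))" for x
      by (simp add: r_def power2_eq_square sum_product of_bool_conj)
    then have "(\<Sum>x\<in>S. (r x)\<^sup>2) = (\<Sum>x\<in>S. \<Sum>X\<in>C. \<Sum>Y\<in>C. of_bool (x \<in> X \<inter> Y))"
      by simp
    also have "\<dots> = (\<Sum>X\<in>C. \<Sum>x\<in>S. \<Sum>Y\<in>C. of_bool (x \<in> X \<inter> Y))"
      by (rule sum.swap)
    also have "\<dots> = (\<Sum>X\<in>C. \<Sum>Y\<in>C. \<Sum>x\<in>S. of_bool (x \<in> X \<inter> Y))"
      by (intro sum.cong refl sum.swap)
    also have "\<dots> = (\<Sum>X\<in>C. \<Sum>Y\<in>C. real (card (X \<inter> Y)))"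
      using sub by (intro sum.cong refl cardI) blast
    also have "\<dots> = (\<Sum>X\<in>C. real (card C) + real n - 1)"
      using row by (intro sum.cong) auto
    finally show ?thesis by simp
  qed
  have "(\<Sum>x\<in>S. (r x - c)\<^sup>2) = (\<Sum>x\<in>S. (r x)\<^sup>2 - 2 * c * r x + c\<^sup>2)"
    by (simp add: power2_diff algebra_simps)
  also have "\<dots> = (\<Sum>x\<in>S. (r x)\<^sup>2) - 2 * c * (\<Sum>x\<in>S. r x) + c\<^sup>2 * real (card S)"
    by (simp add: sum.distrib sum_subtractf sum_distrib_left)
  finally show ?thesis
    unfolding r first second .
qed

section \<open>Counting points and lines of a partial geometry\<close>

context partial_geometry
begin

lemma finite_points_on_line: "l \<in> lines G \<Longrightarrow> finite {p \<in> points G. incident G p l}"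
  by (rule card_ge_0_finite) (simp add: card_points_on_line)

lemma finite_lines_through_point: "p \<in> points G \<Longrightarrow> finite {l \<in> lines G. incident G p l}"
  by (rule card_ge_0_finite) (simp add: card_lines_through_point)

lemma ex_line_through_point:
  assumes "p \<in> points G" obtains l where "l \<in> lines G" "incident G p l"
proof -
  have "{l \<in> lines G. incident G p l} \<noteq> {}"
    using card_lines_through_point[OF assms] by force
  then show ?thesis using that by blast
qed

lemma lines_nonempty: "lines G \<noteq> {}"
  using points_nonempty ex_line_through_point by blast

text \<open>
  Since \<open>\<alpha> \<ge> 1\<close>, every line meets one of the finitely many lines through a fixed point, and
  each of these has only finitely many points with finitely many lines through them.
\<close>

lemma finite_lines: "finite (lines G)"
proof -
  obtain p where p: "p \<in> points G" using points_nonempty by blast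
  define N where "N = (\<Union>k\<in>{k \<in> lines G. incident G p k}. \<Union>q\<in>{q \<in> points G. incident G q k}.
    {l \<in> lines G. incident G q l})"
  have "finite N"
    unfolding N_def using p finite_lines_through_point finite_points_on_line by auto
  moreover have "l \<in> N" if l: "l \<in> lines G" for l
  proof (cases "incident G p l")
    case True
    then show ?thesis using l p by (auto simp: N_def)
  next
    case False
    have "{k \<in> lines G. incident G p k \<and> (\<exists>q\<in>points G. incident G q l \<and> incident G q k)} \<noteq> {}"
      using card_connecting_lines[OF p l False] alpha_ge_1 by force
    then show ?thesis using l by (auto simp: N_def)
  qed
  ultimately show ?thesis by (meson finite_subset subsetI)
qed

lemma finite_points: "finite (points G)"
proof (rule finite_subset)
  show "points G \<subseteq> (\<Union>l\<in>lines G. {p \<in> points G. incident G p l})"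
    using ex_line_through_point by blast
  show "finite (\<Union>l\<in>lines G. {p \<in> points G. incident G p l})"
    using finite_lines finite_points_on_line by blast
qed

lemma card_points_lines: "card (points G) * (t + 1) = card (lines G) * (s + 1)"
proof -
  have "(\<Sum>p\<in>points G. card {l \<in> lines G. incident G p l}) = (\<Sum>l\<in>lines G. s + 1)"
    by (intro sum_multicount_gen finite_points finite_lines) (simp add: card_points_on_line)
  then show ?thesis
    by (simp add: card_lines_through_point)
qed

text \<open>Each of the \<open>s + 1\<close> points of \<open>l\<close> lies on \<open>t\<close> further lines, and these are all distinct.\<close>

lemma card_lines_meeting_line:
  assumes l: "l \<in> lines G"
  shows "card {k \<in> lines G. k \<noteq> l \<and> \<not> disjoint_lines G l k} = (s + 1) * t" (is "card ?K = _")
proof -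
  let ?Q = "{q \<in> points G. incident G q l}"
  have through: "card {k \<in> ?K. incident G q k} = t" if q: "q \<in> ?Q" for q
  proof -
    have "{k \<in> ?K. incident G q k} = {k \<in> lines G. incident G q k} - {l}"
      using q by (auto simp: disjoint_lines_def)
    then show ?thesis
      using q l card_lines_through_point[of q] by (simp add: card_Diff_singleton)
  qed
  have once: "card {q \<in> ?Q. incident G q k} = 1" if k: "k \<in> ?K" for k
  proof -
    obtain q where q: "q \<in> points G" "incident G q l" "incident G q k"
      using k by (auto simp: disjoint_lines_def)
    then have "{q \<in> ?Q. incident G q k} = {q}"
      using line_unique[of _ q l k] k l by blast
    then show ?thesis by simp
  qed
  have "(\<Sum>q\<in>?Q. card {k \<in> ?K. incident G q k}) = (\<Sum>k\<in>?K. 1)"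
    using finite_points finite_lines once by (intro sum_multicount_gen) auto
  moreover have "(\<Sum>q\<in>?Q. card {k \<in> ?K. incident G q k}) = (\<Sum>q\<in>?Q. t)"
    using through by (intro sum.cong) auto
  ultimately show ?thesis
    using card_points_on_line[OF l] by simp
qed

text \<open>
  Fix a line \<open>l\<close> and count the pairs of a point \<open>p\<close> off \<open>l\<close> and a line through \<open>p\<close> that meets
  \<open>l\<close>: there are \<open>\<alpha>\<close> such lines for every \<open>p\<close>, and \<open>s\<close> such points on every line
  other than \<open>l\<close> that meets \<open>l\<close>.
\<close>

lemma card_points_formula: "card (points G) * \<alpha> = (s + 1) * (s * t + \<alpha>)"
proof -
  obtain l where l: "l \<in> lines G" using lines_nonempty by blast
  let ?K = "{k \<in> lines G. k \<noteq> l \<and> \<not> disjoint_lines G l k}"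
  let ?P = "{p \<in> points G. \<not> incident G p l}"
  have through: "card {k \<in> ?K. incident G p k} = \<alpha>" if p: "p \<in> ?P" for p
  proof -
    have "{k \<in> ?K. incident G p k} =
        {k \<in> lines G. incident G p k \<and> (\<exists>q\<in>points G. incident G q l \<and> incident G q k)}"
      using p by (auto simp: disjoint_lines_def)
    then show ?thesis using card_connecting_lines[of p l] p l by simp
  qed
  have on: "card {p \<in> ?P. incident G p k} = s" if k: "k \<in> ?K" for k
  proof -
    obtain q where q: "q \<in> points G" "incident G q l" "incident G q k"
      using k by (auto simp: disjoint_lines_def)
    then have "{p \<in> ?P. incident G p k} = {p \<in> points G. incident G p k} - {q}"
      using line_unique[of _ q l k] k l by blast
    then show ?thesis
      using q k card_points_on_line[of k] by (simp add: card_Diff_singleton)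
  qed
  have "(\<Sum>p\<in>?P. card {k \<in> ?K. incident G p k}) = (\<Sum>k\<in>?K. s)"
    using finite_points finite_lines on by (intro sum_multicount_gen) auto
  moreover have "(\<Sum>p\<in>?P. card {k \<in> ?K. incident G p k}) = (\<Sum>p\<in>?P. \<alpha>)"
    using through by (intro sum.cong) auto
  ultimately have count: "card ?P * \<alpha> = (s + 1) * t * s"
    using card_lines_meeting_line[OF l] by simp
  have "card (points G) = card {p \<in> points G. incident G p l} + card ?P"
    using finite_points by (subst card_Un_disjoint[symmetric]) (auto intro!: arg_cong[where f = card])
  then have "card (points G) = s + 1 + card ?P"
    using card_points_on_line[OF l] by simp
  then show ?thesis
    using count by (simp add: algebra_simps)
qed

section \<open>The dual geometry\<close>

text \<open>
  Only the last axiom needs an argument: for \<open>p\<close> off \<open>l\<close>, mapping a line through \<open>p\<close> that meets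
  \<open>l\<close> to the meeting point is a bijection onto the points of \<open>l\<close> collinear with \<open>p\<close>.
\<close>

lemma card_collinear_points:
  assumes p: "p \<in> points G" and l: "l \<in> lines G" and off: "\<not> incident G p l"
  shows "card {q \<in> points G. incident G q l \<and>
           (\<exists>k\<in>lines G. incident G p k \<and> incident G q k)} = \<alpha>" (is "card ?Q = _")
proof -
  let ?K = "{k \<in> lines G. incident G p k \<and> (\<exists>q\<in>points G. incident G q l \<and> incident G q k)}"
  have "(\<Sum>q\<in>?Q. card {k \<in> ?K. incident G q k}) = (\<Sum>k\<in>?K. 1)"
  proof (intro sum_multicount_gen ballI)
    fix k assume k: "k \<in> ?K"
    then obtain q where q: "q \<in> points G" "incident G q l" "incident G q k" by blast
    then have "{q \<in> ?Q. incident G q k} = {q}"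
      using line_unique[of _ q l k] k l p off by blast
    then show "card {q \<in> ?Q. incident G q k} = 1" by simp
  qed (use finite_points finite_lines in auto)
  moreover have "card {k \<in> ?K. incident G q k} = 1" if q: "q \<in> ?Q" for q
  proof -
    obtain k where k: "k \<in> lines G" "incident G p k" "incident G q k" using q by blast
    then have "{k \<in> ?K. incident G q k} = {k}"
      using line_unique[of p q] q p off by blast
    then show ?thesis by simp
  qed
  ultimately have "card ?Q = card ?K" by simp
  then show ?thesis using card_connecting_lines[OF p l off] by simp
qed

lemma partial_geometry_dual: "partial_geometry (dual_geometry G) t s \<alpha>"
proof -
  have sel: "points (dual_geometry G) = lines G" "lines (dual_geometry G) = points G"
    "incident (dual_geometry G) l p = incident G p l" for p l
    by (simp_all add: dual_geometry_def)
  show ?thesis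
  proof (rule partial_geometry.intro, unfold sel)
    fix p q l k
    assume "p \<in> lines G" "q \<in> lines G" "p \<noteq> q" "l \<in> points G" "k \<in> points G"
      "incident G l p" "incident G l q" "incident G k p" "incident G k q"
    then show "l = k" using line_unique[of l k p q] by blast
  next
    fix p l
    assume "p \<in> lines G" "l \<in> points G" "\<not> incident G l p"
    then show "card {k \<in> points G. incident G k p \<and>
        (\<exists>q\<in>lines G. incident G l q \<and> incident G k q)} = \<alpha>"
      by (intro card_collinear_points)
  qed (fact lines_nonempty s_ge_1 t_ge_1 alpha_ge_1 card_points_on_line card_lines_through_point)+
qed

end

section \<open>The bound on orthogonal parallel classes\<close>

text \<open>
  The parameters are such that \<open>s * t + \<alpha> = \<alpha> * (d * d' + 1)\<close>, so the point count cancels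
  \<open>\<alpha>\<close> and every parallel class has \<open>n = d * d' + 1\<close> lines.  Deviations of the number of classes
  through a line are taken from the mean of these numbers: expanding around \<open>d\<close> instead gives
  \<open>(d * (t + 1) - m) * (d * n - m)\<close> as the sum of squares, whose sign would not exclude
  \<open>m \<ge> d * n\<close>.
\<close>

lemma orthogonal_parallel_classes_bound:
  fixes G :: "('p, 'l) geometry" and C :: "'l set set"
  assumes d: "d \<ge> 2" and d': "d' \<ge> 2"
    and geo: "partial_geometry G s t \<alpha>"
    and s: "s = d * (d' - 1)" and t: "t = d' * (d - 1)" and \<alpha>: "\<alpha> = (d - 1) * (d' - 1)"
    and par: "\<And>X. X \<in> C \<Longrightarrow> parallel_class s G X"
    and orth: "pairwise orthogonal_classes C"
  shows "card C \<le> d * (t + 1)"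
    and "card C = d * (t + 1) \<longleftrightarrow> (\<forall>l\<in>lines G. card {X \<in> C. l \<in> X} = d)"
proof -
  interpret partial_geometry G s t \<alpha> by (rule geo)
  define n where "n = d * d' + 1"
  define m where "m = card C"
  define r where "r = (\<lambda>l. card {X \<in> C. l \<in> X})"
  obtain e e' where e: "d = Suc e" "d' = Suc e'"
    using d d' by (metis Suc_le_D numeral_2_eq_2)
  have "card (points G) * \<alpha> = ((s + 1) * n) * \<alpha>"
    using card_points_formula by (simp add: s t \<alpha> n_def e algebra_simps)
  then have points: "card (points G) = (s + 1) * n"
    using alpha_ge_1 by simp
  then have "card (lines G) * (s + 1) = ((t + 1) * n) * (s + 1)"
    using card_points_lines by (simp add: algebra_simps)
  then have lines: "card (lines G) = (t + 1) * n"
    by (metis add_is_0 mult_cancel2 one_neq_zero)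
  have size: "card X = n" if "X \<in> C" for X
  proof -
    have "real (card X) = real ((s + 1) * n) / real (s + 1)"
      using par[OF that] points by (simp only: parallel_class_def)
    then have "real (card X) = real n"
      using nonzero_mult_div_cancel_left[of "real (s + 1)" "real n"] by (simp only: of_nat_mult)
    then show ?thesis by simp
  qed
  have sub: "X \<subseteq> lines G" if "X \<in> C" for X
    using par[OF that] by (simp add: parallel_class_def)
  have deviation: "(\<Sum>l\<in>lines G. (real (r l) - c)\<^sup>2) =
      real m * (real m + real n - 1) - 2 * c * (real m * real n) + c\<^sup>2 * (real (t + 1) * real n)" for c
    using sum_squared_deviation_of_membership_counts[of "lines G" C n c] finite_lines sub size orth lines
    unfolding m_def r_def by (simp only: of_nat_mult)
  define T where "T = real t + 1"
  have T: "T > 0" "real (t + 1) = T" by (simp_all add: T_def)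
  have n: "real n - T = real d'" "real n - 1 = real d * real d'"
    by (simp_all add: T_def t n_def e algebra_simps)
  have variance: "T * (\<Sum>l\<in>lines G. (real (r l) - real m / T)\<^sup>2) =
      real m * real d' * (real d * T - real m)"
  proof -
    have "T * (\<Sum>l\<in>lines G. (real (r l) - real m / T)\<^sup>2) =
        T * (real m * (real m + real n - 1)) - real m * real m * real n"
      unfolding deviation T(2) using T(1) by (simp add: power2_eq_square right_diff_distrib distrib_left)
    also have "\<dots> = real m * (T * (real n - 1) - (real n - T) * real m)"
      by (simp add: algebra_simps)
    also have "\<dots> = real m * real d' * (real d * T - real m)"
      unfolding n by (simp add: algebra_simps)
    finally show ?thesis .
  qed
  have "0 \<le> T * (\<Sum>l\<in>lines G. (real (r l) - real m / T)\<^sup>2)"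
    using T(1) by (intro mult_nonneg_nonneg sum_nonneg) auto
  then have "real m \<le> real d * T"
    unfolding variance using d' T(1) by (cases "m = 0") (auto simp: zero_le_mult_iff mult_le_0_iff)
  then have "real m \<le> real (d * (t + 1))"
    by (simp only: of_nat_mult T(2))
  then show "card C \<le> d * (t + 1)"
    unfolding m_def of_nat_le_iff .
  have "r l = d" if "m = d * (t + 1)" and l: "l \<in> lines G" for l
  proof -
    have m: "real m = real d * T"
      using that by (simp only: of_nat_mult T(2))
    have "(\<Sum>l\<in>lines G. (real (r l) - real m / T)\<^sup>2) = 0"
      using variance m T(1) by simp
    then have "real (r l) = real m / T"
      using l finite_lines by (simp add: sum_nonneg_eq_0_iff)
    then show ?thesis
      using m T(1) by simp
  qed
  (* The converse compares first moments: m classes of n lines each against d for every line. *)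
  moreover have "m = d * (t + 1)" if const: "\<forall>l\<in>lines G. r l = d"
  proof -
    have finC: "finite C"
      using sub finite_lines by (meson Pow_iff finite_Pow_iff finite_subset subsetI)
    have "(\<Sum>l\<in>lines G. r l) = (\<Sum>X\<in>C. n)"
      unfolding r_def
    proof (intro sum_multicount_gen ballI finite_lines finC)
      fix X assume X: "X \<in> C"
      then have "{l \<in> lines G. l \<in> X} = X" using sub by blast
      then show "card {l \<in> lines G. l \<in> X} = n" using size X by simp
    qed
    then have "m * n = d * (t + 1) * n"
      using const by (simp add: lines m_def algebra_simps)
    then show ?thesis unfolding mult_cancel2 by (simp add: n_def)
  qed
  ultimately show "card C = d * (t + 1) \<longleftrightarrow> (\<forall>l\<in>lines G. card {X \<in> C. l \<in> X} = d)"
    unfolding m_def r_def by blast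
qed

theorem theorem2p3:
  fixes G :: "('p, 'l) geometry" and d d' s t \<alpha> :: nat
  assumes "d \<ge> 2" and "d' \<ge> 2"
    and "partial_geometry G s t \<alpha>"
    and "s = d * (d' - 1)"
    and "t = d' * (d - 1)"
    and "\<alpha> = (d - 1) * (d' - 1)"
  shows
    "(\<forall>(C :: 'l set set) m.
        (\<forall>X\<in>C. parallel_class s G X) \<and> pairwise orthogonal_classes C \<and> card C = m \<longrightarrow>
          m \<le> d * (d * d' - d' + 1) \<and>
          (m = d * (d * d' - d' + 1) \<longleftrightarrow>
             (\<forall>l\<in>lines G. card {X \<in> C. l \<in> X} = d))) \<and>
     (\<forall>(C' :: 'p set set) m'.
        (\<forall>X\<in>C'. parallel_class t (dual_geometry G) X) \<and> pairwise orthogonal_classes C' \<and>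
        card C' = m' \<longrightarrow>
          m' \<le> d' * (d' * d - d + 1) \<and>
          (m' = d' * (d' * d - d + 1) \<longleftrightarrow>
             (\<forall>l\<in>lines (dual_geometry G). card {X \<in> C'. l \<in> X} = d')))"
proof -
  have t: "t = d * d' - d'" and s: "s = d' * d - d"
    using assms by (simp_all add: diff_mult_distrib2 mult.commute)
  have dual: "partial_geometry (dual_geometry G) t s \<alpha>"
    using assms(3) by (rule partial_geometry.partial_geometry_dual)
  have \<alpha>: "\<alpha> = (d' - 1) * (d - 1)"
    using assms(6) by (simp add: mult.commute)
  note bound = orthogonal_parallel_classes_bound[OF assms]
  note dual_bound = orthogonal_parallel_classes_bound[OF assms(2,1) dual assms(5,4) \<alpha>]
  show ?thesis
  proof (intro conjI allI impI; elim conjE)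
    fix C :: "'l set set" and m
    assume C: "\<forall>X\<in>C. parallel_class s G X" "pairwise orthogonal_classes C" and m: "card C = m"
    show "m \<le> d * (d * d' - d' + 1)"
      and "m = d * (d * d' - d' + 1) \<longleftrightarrow> (\<forall>l\<in>lines G. card {X \<in> C. l \<in> X} = d)"
      using bound[of C] C unfolding m t[symmetric] by blast+
  next
    fix C' :: "'p set set" and m'
    assume C': "\<forall>X\<in>C'. parallel_class t (dual_geometry G) X" "pairwise orthogonal_classes C'"
      and m': "card C' = m'"
    show "m' \<le> d' * (d' * d - d + 1)"
      and "m' = d' * (d' * d - d + 1) \<longleftrightarrow>
        (\<forall>l\<in>lines (dual_geometry G). card {X \<in> C'. l \<in> X} = d')"
      using dual_bound[of C'] C' unfolding m' s[symmetric] by blast+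
  qed
qed

end
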